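(* Let $m,n,d$ be positive integers. If $n \geq 3$ and $d \geq \frac{(m+1)(m+2)}{2}$, then $\operatorname{uMPS}(m,n,d)$ is contained in a proper linear subspace of the space $\operatorname{Cyc}^d(\mathbb{C}^n)$ of cyclically invariant tensors.
   Context: Let $e_0,\dots,e_{n-1}$ be the standard basis of $\mathbb{C}^n$. Consider the map $$\phi\colon (\mathbb{C}^{m\times m})^n \to (\mathbb{C}^n)^{\otimes d},\qquad (A_0,\dots,A_{n-1}) \mapsto \sum_{0\le i_1,\dots,i_d\le n-1} \operatorname{Tr}(A_{i_1}\cdots A_{i_d})\, e_{i_1}\otimes\cdots\otimes e_{i_d}.$$ $\operatorname{uMPS}(m,n,d)$ is the closure (equivalently in the Euclidean or the Zariski topology) of the image of $\phi$. The symmetric group $\mathfrak{S}_d$ acts linearly on $(\mathbb{C}^n)^{\otimes d}$ by $\sigma\cdot(v_1\otimes\cdots\otimes v_d) = v_{\sigma^{-1}(1)}\otimes\cdots\otimes v_{\sigma^{-1}(d)}$. Let $C_d\subseteq \mathfrak{S}_d$ be the cyclic subgroup generated by $i\mapsto i+1 \pmod d$. Then $\operatorname{Cyc}^d(\mathbb{C}^n) = \{\omega\in(\mathbb{C}^n)^{\otimes d} \mid \sigma\cdot\omega=\omega \ \forall \sigma\in C_d\}$. (Because the trace is invariant under cyclic permutation of factors, $\operatorname{uMPS}(m,n,d)\subseteq\operatorname{Cyc}^d(\mathbb{C}^n)$.) *)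

theory Defs
  imports
    "HOL-Analysis.Function_Topology"
    "HOL-Algebra.Generated_Groups"
    "HOL-Combinatorics.Permutations"
    "HOL-Library.Function_Algebras"
    "Jordan_Normal_Form.Matrix"
begin

text \<open>
  A tensor in the \<open>d\<close>-fold tensor power of \<open>\<complex>\<^sup>n\<close> is represented by its family of coordinates with
  respect to the basis \<open>e\<^bsub>i\<^sub>1\<^esub> \<otimes> \<dots> \<otimes> e\<^bsub>i\<^sub>d\<^esub>\<close>, extended by \<open>0\<close> to all lists that are not multi-indices.
  Addition is pointwise.  The topology on the function type is the
  product topology; as only finitely many coordinates are nonzero on \<open>tensors n d\<close>, it
  induces there the Euclidean topology, and \<open>tensors n d\<close> is closed.
\<close>

type_synonym tensor = "nat list \<Rightarrow> complex"

definition multi_indices :: "nat \<Rightarrow> nat \<Rightarrow> nat list set" where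
  "multi_indices n d = {is. length is = d \<and> set is \<subseteq> {..<n}}"

definition tensors :: "nat \<Rightarrow> nat \<Rightarrow> tensor set" where
  "tensors n d = {T. \<forall>is. is \<notin> multi_indices n d \<longrightarrow> T is = 0}"

definition tensor_scale :: "complex \<Rightarrow> tensor \<Rightarrow> tensor" where
  "tensor_scale c T = (\<lambda>is. c * T is)"

interpretation tensor: vector_space tensor_scale
  by unfold_locales (simp_all add: tensor_scale_def fun_eq_iff distrib_left distrib_right)

definition pure_tensor :: "nat \<Rightarrow> complex vec list \<Rightarrow> tensor" where
  "pure_tensor n vs = (\<lambda>is. if is \<in> multi_indices n (length vs)
     then \<Prod>k<length vs. (vs ! k) $ (is ! k) else 0)"

definition mat_trace :: "'a :: comm_monoid_add mat \<Rightarrow> 'a" where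
  "mat_trace M = (\<Sum>i<dim_row M. M $$ (i, i))"

definition mat_list_prod :: "nat \<Rightarrow> 'a :: semiring_1 mat list \<Rightarrow> 'a mat" where
  "mat_list_prod m Ms = foldr (*) Ms (1\<^sub>m m)"

definition mps_map :: "nat \<Rightarrow> nat \<Rightarrow> nat \<Rightarrow> (nat \<Rightarrow> complex mat) \<Rightarrow> tensor" where
  "mps_map m n d A = (\<Sum>is \<in> multi_indices n d.
     tensor_scale (mat_trace (mat_list_prod m (map A is))) (pure_tensor n (map (unit_vec n) is)))"

definition uMPS :: "nat \<Rightarrow> nat \<Rightarrow> nat \<Rightarrow> tensor set" where
  "uMPS m n d = closure (mps_map m n d ` {A. \<forall>i<n. A i \<in> carrier_mat m m})"

lemma mps_map_coord:
  "mps_map m n d A is =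
    (if is \<in> multi_indices n d then mat_trace (mat_list_prod m (map A is)) else 0)"
proof -
  have fin: "finite (multi_indices n d)"
    using finite_lists_length_eq[of "{..<n}" d]
    by (simp add: multi_indices_def conj_commute)
  have unit: "pure_tensor n (map (unit_vec n) js) is = (if js = is then 1 else 0)"
    if js: "js \<in> multi_indices n d" for js
  proof (cases "is \<in> multi_indices n d")
    case True
    have len: "length is = length js"
      using js True by (simp add: multi_indices_def)
    have lt: "js ! k < n \<and> is ! k < n" if "k < length js" for k
    proof -
      have "js ! k \<in> set js" "is ! k \<in> set is"
        using that len by simp_all
      then show ?thesis
        using js True unfolding multi_indices_def by blast
    qed
    have "pure_tensor n (map (unit_vec n) js) is
        = (\<Prod>k<length js. if is ! k = js ! k then 1 else 0 :: complex)"
    proof -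
      have "pure_tensor n (map (unit_vec n) js) is
          = (\<Prod>k<length js. (map (unit_vec n) js ! k) $ (is ! k))"
        using js True by (simp add: pure_tensor_def multi_indices_def)
      also have "\<dots> = (\<Prod>k<length js. if is ! k = js ! k then 1 else 0)"
        by (intro prod.cong refl) (simp add: lt)
      finally show ?thesis .
    qed
    also have "\<dots> = (if js = is then 1 else 0)"
    proof (cases "js = is")
      case False
      then obtain k where "k < length js" "is ! k \<noteq> js ! k"
        using len by (metis nth_equalityI)
      then have "(\<Prod>k<length js. if is ! k = js ! k then 1 else 0 :: complex) = 0"
        by (intro prod_zero) auto
      then show ?thesis using False by simp
    qed simp
    finally show ?thesis .
  qed (use js in \<open>auto simp: pure_tensor_def multi_indices_def\<close>)
  have apply_sum: "(\<Sum>js\<in>J. F js) is = (\<Sum>js\<in>J. F js is)"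
    for J and F :: "nat list \<Rightarrow> tensor"
    by (induction J rule: infinite_finite_induct) auto
  have "mps_map m n d A is = (\<Sum>js\<in>multi_indices n d.
      if js = is then mat_trace (mat_list_prod m (map A js)) else 0)"
    unfolding mps_map_def apply_sum by (rule sum.cong) (simp_all add: tensor_scale_def unit)
  then show ?thesis by (simp add: fin)
qed

text \<open>
  In coordinates, \<open>(\<sigma> \<cdot> T)(i\<^sub>1, \<dots>, i\<^sub>d) = T(i\<^bsub>\<sigma>(1)\<^esub>, \<dots>, i\<^bsub>\<sigma>(d)\<^esub>)\<close>; lemma \<open>tensor_act_pure_tensor\<close>
  below shows that this is the action
  \<open>v\<^sub>1 \<otimes> \<dots> \<otimes> v\<^sub>d \<mapsto> v\<^bsub>\<sigma>\<inverse>(1)\<^esub> \<otimes> \<dots> \<otimes> v\<^bsub>\<sigma>\<inverse>(d)\<^esub>\<close>.  Positions are numbered from \<open>0\<close> to \<open>d - 1\<close>.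
\<close>

definition tensor_act :: "(nat \<Rightarrow> nat) \<Rightarrow> tensor \<Rightarrow> tensor" where
  "tensor_act \<sigma> T = (\<lambda>is. T (permute_list \<sigma> is))"

definition perm_group :: "nat \<Rightarrow> (nat \<Rightarrow> nat) monoid" where
  "perm_group d = \<lparr>carrier = {\<sigma>. \<sigma> permutes {..<d}}, monoid.mult = (\<circ>), one = id\<rparr>"

definition cyclic_shift :: "nat \<Rightarrow> nat \<Rightarrow> nat" where
  "cyclic_shift d i = (if i < d then (i + 1) mod d else i)"

definition cyclic_perms :: "nat \<Rightarrow> (nat \<Rightarrow> nat) set" where
  "cyclic_perms d = generate (perm_group d) {cyclic_shift d}"

definition Cyc :: "nat \<Rightarrow> nat \<Rightarrow> tensor set" where
  "Cyc n d = {T \<in> tensors n d. \<forall>\<sigma> \<in> cyclic_perms d. tensor_act \<sigma> T = T}"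

lemma tensor_act_linear:
  "tensor_act \<sigma> (S + T) = tensor_act \<sigma> S + tensor_act \<sigma> T"
  "tensor_act \<sigma> (tensor_scale c T) = tensor_scale c (tensor_act \<sigma> T)"
  by (simp_all add: tensor_act_def tensor_scale_def fun_eq_iff)

lemma tensor_act_pure_tensor:
  assumes "\<sigma> permutes {..<length vs}"
  shows "tensor_act \<sigma> (pure_tensor n vs) = pure_tensor n (permute_list (inv_into UNIV \<sigma>) vs)"
proof (rule ext)
  fix js :: "nat list"
  show "tensor_act \<sigma> (pure_tensor n vs) js = pure_tensor n (permute_list (inv_into UNIV \<sigma>) vs) js"
  proof (cases "length js = length vs")
    case True
    have perm_inv: "inv_into UNIV \<sigma> permutes {..<length vs}"
      using assms by (rule permutes_inv)
    have "(\<Prod>k<length vs. (vs ! k) $ (permute_list \<sigma> js ! k))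
        = (\<Prod>k<length vs. (vs ! k) $ (js ! \<sigma> k))"
      using assms True by (intro prod.cong refl arg_cong[of _ _ "($) _"]) (simp add: permute_list_nth)
    also have "\<dots> = (\<Prod>k<length vs. (vs ! inv_into UNIV \<sigma> k) $ (js ! \<sigma> (inv_into UNIV \<sigma> k)))"
      using prod.permute[OF perm_inv, of "\<lambda>k. (vs ! k) $ (js ! \<sigma> k)"] by (simp only: o_def)
    also have "\<dots> = (\<Prod>k<length vs. (permute_list (inv_into UNIV \<sigma>) vs ! k) $ (js ! k))"
      by (intro prod.cong refl)
        (simp add: permute_list_nth[OF perm_inv] permutes_inverses(1)[OF assms])
    finally show ?thesis
      using assms True by (simp add: tensor_act_def pure_tensor_def multi_indices_def)
  qed (simp add: tensor_act_def pure_tensor_def multi_indices_def)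
qed

lemma cyclic_shift_permutes: "cyclic_shift d permutes {..<d}"
proof (rule bij_imp_permutes)
  have "inj_on (cyclic_shift d) {..<d}"
  proof (rule inj_onI)
    fix i j assume "i \<in> {..<d}" "j \<in> {..<d}" "cyclic_shift d i = cyclic_shift d j"
    moreover have "cyclic_shift d k = (if Suc k = d then 0 else Suc k)" if "k < d" for k
      using that by (simp add: cyclic_shift_def)
    ultimately show "i = j" by (simp split: if_splits)
  qed
  moreover have "cyclic_shift d ` {..<d} \<subseteq> {..<d}"
    by (auto simp: cyclic_shift_def)
  ultimately show "bij_betw (cyclic_shift d) {..<d} {..<d}"
    unfolding bij_betw_def by (intro conjI endo_inj_surj finite_lessThan)
qed (simp add: cyclic_shift_def)

end

theory Submission
  imports Defs "Jordan_Normal_Form.Char_Poly"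
begin

text \<open>
  By Cayley--Hamilton the powers \<open>1, X, \<dots>, X\<^sup>m\<close> of an \<open>m \<times> m\<close> matrix are linearly dependent, so every
  multilinear alternating expression in them vanishes.  In particular
  \<open>\<Sum>\<^sub>\<sigma> sgn(\<sigma>) X\<^bsup>\<sigma>(0)\<^esup> Y X\<^bsup>\<sigma>(1)\<^esup> Y \<dots> Y X\<^bsup>\<sigma>(m)\<^esup> = 0\<close>, an identity of degree \<open>m(m+3)/2 = (m+1)(m+2)/2 - 1\<close>.
  Multiplying by \<open>Z\<^sup>k\<close> with \<open>k = d - m(m+3)/2 \<ge> 1\<close> and taking traces gives a linear form on tensors that
  vanishes on the image of \<open>\<phi>\<close>, hence on its closure.  The form is nonzero on cyclically invariant
  tensors: the single block \<open>Z\<^sup>k\<close> marks the end of each word, so words for different \<open>\<sigma>\<close> are not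
  rotations of each other.
\<close>

section \<open>Cayley-Hamilton and a vanishing determinant of powers\<close>

lemma mult_mat_entry:
  assumes "A \<in> carrier_mat l m" "B \<in> carrier_mat m n" "i < l" "j < n"
  shows "(A * B) $$ (i, j) = (\<Sum>k<m. A $$ (i, k) * B $$ (k, j))"
  using assms by (auto simp: scalar_prod_def lessThan_atLeast0 intro!: sum.cong)

text \<open>The adjugate of \<open>t - A\<close>, a matrix of polynomials, is read as the sequence
  \<open>B s\<close> of its coefficient matrices. The entrywise form gives one linear relation per
  position \<open>(i, j)\<close>, always with the same coefficients, so that these form a common
  kernel vector later.\<close>

lemma cayley_hamilton_entries:
  fixes A :: "'a :: comm_ring_1 mat"
  assumes A: "A \<in> carrier_mat m m" and i: "i < m" and j: "j < m"
  shows "(\<Sum>s\<le>degree (char_poly A). coeff (char_poly A) s * (A ^\<^sub>m s) $$ (i, j)) = 0"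
proof -
  define C where "C = char_poly_matrix A"
  define p where "p = char_poly A"
  define B where "B s = mat m m (\<lambda>(i, j). coeff (adj_mat C $$ (i, j)) s)" for s
  have C: "C \<in> carrier_mat m m" using A by (simp add: C_def)
  have det_C: "det C = p" by (simp add: C_def p_def char_poly_def)
  have adj: "adj_mat C \<in> carrier_mat m m" by (rule adj_mat(1)[OF C])
  have B: "B s \<in> carrier_mat m m" for s by (simp add: B_def)
  have B_entry: "B s $$ (i, j) = coeff (adj_mat C $$ (i, j)) s" if "i < m" "j < m" for s i j
    using that by (simp add: B_def)
  have entry: "(\<Sum>k<m. adj_mat C $$ (i, k) * C $$ (k, j)) = (if i = j then p else 0)"
    if "i < m" "j < m" for i j
  proof -
    have "(adj_mat C * C) $$ (i, j) = (\<Sum>k<m. adj_mat C $$ (i, k) * C $$ (k, j))"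
      by (rule mult_mat_entry[OF adj C that])
    moreover have "(adj_mat C * C) $$ (i, j) = (if i = j then p else 0)"
      using that by (simp add: adj_mat(3)[OF C] det_C)
    ultimately show ?thesis by simp
  qed
  have C_entry: "C $$ (k, j) = (if k = j then [:0, 1:] else 0) - [:A $$ (k, j):]"
    if "k < m" "j < m" for k j
    using that A by (simp add: C_def char_poly_matrix_def)
  have poly_eq: "pCons 0 (adj_mat C $$ (i, j)) - (\<Sum>k<m. smult (A $$ (k, j)) (adj_mat C $$ (i, k)))
      = (if i = j then p else 0)" if ij: "i < m" "j < m" for i j
  proof -
    have "(\<Sum>k<m. adj_mat C $$ (i, k) * C $$ (k, j))
        = (\<Sum>k<m. (if k = j then pCons 0 (adj_mat C $$ (i, k)) else 0)
            - smult (A $$ (k, j)) (adj_mat C $$ (i, k)))"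
      by (intro sum.cong refl) (use ij in \<open>auto simp: C_entry algebra_simps\<close>)
    also have "\<dots> = pCons 0 (adj_mat C $$ (i, j)) - (\<Sum>k<m. smult (A $$ (k, j)) (adj_mat C $$ (i, k)))"
      using ij by (simp add: sum_subtractf)
    finally show ?thesis using entry[OF ij] by simp
  qed
  have BA: "(B s * A) $$ (i, j) = (\<Sum>k<m. A $$ (k, j) * coeff (adj_mat C $$ (i, k)) s)"
    if "i < m" "j < m" for s i j
    using that by (simp add: mult_mat_entry[OF B A] B_entry mult.commute)
  \<comment> \<open>The value 0 at \<open>s = 0\<close> is the convention B_(-1) = 0; it comes from
    the shift \<open>pCons 0\<close>, that is, multiplication by t.\<close>
  have coeff_eq: "(case s of 0 \<Rightarrow> 0 | Suc s' \<Rightarrow> B s' $$ (i, j)) - (B s * A) $$ (i, j)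
      = (if i = j then coeff p s else 0)" if ij: "i < m" "j < m" for s i j
    using arg_cong[OF poly_eq[OF ij], of "\<lambda>q. coeff q s"] ij
    by (simp add: BA coeff_sum coeff_pCons B_entry split: nat.splits if_splits)
  \<comment> \<open>Comparing coefficients in \<open>adj(t - A) (t - A) = p(t)\<close> gives \<open>B\<^bsub>s-1\<^esub> - B\<^sub>s A = p\<^sub>s\<close>; multiplied by \<open>A\<^sup>s\<close> this telescopes.\<close>
  have step_entry: "coeff p s * (A ^\<^sub>m s) $$ (i, j)
      = (case s of 0 \<Rightarrow> 0 | Suc s' \<Rightarrow> (B s' * A ^\<^sub>m s) $$ (i, j)) - (B s * A ^\<^sub>m Suc s) $$ (i, j)" for s
  proof -
    have pw: "A ^\<^sub>m s \<in> carrier_mat m m" using A by simp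
    \<comment> \<open>\<open>pow_mat\<close> adds factors on the right, but the recursion produces
      \<open>B s * A\<close> and so needs a factor \<open>A\<close> on the left of the
      power.\<close>
    have comm: "A ^\<^sub>m Suc s = A * A ^\<^sub>m s"
      using A by (induction s) (simp_all add: assoc_mult_mat[of _ m m _ m _ m])
    have "(B s * A ^\<^sub>m Suc s) $$ (i, j) = ((B s * A) * A ^\<^sub>m s) $$ (i, j)"
      by (subst comm) (simp add: assoc_mult_mat[OF B A pw])
    also have "\<dots> = (\<Sum>k<m. (B s * A) $$ (i, k) * (A ^\<^sub>m s) $$ (k, j))"
      by (rule mult_mat_entry[OF mult_carrier_mat[OF B A] pw i j])
    also have "\<dots> = (\<Sum>k<m. (case s of 0 \<Rightarrow> 0 | Suc s' \<Rightarrow> B s' $$ (i, k)) * (A ^\<^sub>m s) $$ (k, j)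
        - (if i = k then coeff p s * (A ^\<^sub>m s) $$ (k, j) else 0))"
    proof (intro sum.cong refl)
      fix k assume "k \<in> {..<m}"
      then have "(B s * A) $$ (i, k) = (case s of 0 \<Rightarrow> 0 | Suc s' \<Rightarrow> B s' $$ (i, k))
          - (if i = k then coeff p s else 0)"
        using coeff_eq[OF i, of k s] by (simp add: algebra_simps)
      then show "(B s * A) $$ (i, k) * (A ^\<^sub>m s) $$ (k, j) =
          (case s of 0 \<Rightarrow> 0 | Suc s' \<Rightarrow> B s' $$ (i, k)) * (A ^\<^sub>m s) $$ (k, j)
          - (if i = k then coeff p s * (A ^\<^sub>m s) $$ (k, j) else 0)"
        by (simp add: left_diff_distrib)
    qed
    also have "\<dots> = (\<Sum>k<m. (case s of 0 \<Rightarrow> 0 | Suc s' \<Rightarrow> B s' $$ (i, k)) * (A ^\<^sub>m s) $$ (k, j))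
        - coeff p s * (A ^\<^sub>m s) $$ (i, j)"
      using i by (simp add: sum_subtractf)
    also have "(\<Sum>k<m. (case s of 0 \<Rightarrow> 0 | Suc s' \<Rightarrow> B s' $$ (i, k)) * (A ^\<^sub>m s) $$ (k, j))
        = (case s of 0 \<Rightarrow> 0 | Suc s' \<Rightarrow> (B s' * A ^\<^sub>m s) $$ (i, j))"
      by (simp add: mult_mat_entry[OF B pow_carrier_mat[OF A] i j] split: nat.split del: pow_mat.simps)
    finally show ?thesis by (simp del: pow_mat.simps)
  qed
  have telescope: "(\<Sum>s\<le>N. coeff p s * (A ^\<^sub>m s) $$ (i, j)) = - (B N * A ^\<^sub>m Suc N) $$ (i, j)" for N
    by (induction N) (simp_all add: step_entry del: pow_mat.simps)
  \<comment> \<open>Past all degrees in row \<open>i\<close> of the adjugate, row \<open>i\<close>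
    of \<open>B N\<close> is zero, which kills the remainder of the telescoping sum.\<close>
  obtain N where N: "degree p \<le> N" "\<And>k. k < m \<Longrightarrow> degree (adj_mat C $$ (i, k)) < N"
  proof
    let ?N = "Suc (degree p + (\<Sum>k<m. degree (adj_mat C $$ (i, k))))"
    show "degree p \<le> ?N" by simp
    fix k assume "k < m"
    then have "degree (adj_mat C $$ (i, k)) \<le> (\<Sum>k<m. degree (adj_mat C $$ (i, k)))"
      by (intro member_le_sum) auto
    then show "degree (adj_mat C $$ (i, k)) < ?N" by simp
  qed
  have "(B N * A ^\<^sub>m Suc N) $$ (i, j) = (\<Sum>k<m. B N $$ (i, k) * (A ^\<^sub>m Suc N) $$ (k, j))"
    by (rule mult_mat_entry[OF B pow_carrier_mat[OF A] i j])
  also have "\<dots> = 0"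
    using i N(2) by (intro sum.neutral) (simp add: B_def coeff_eq_0)
  finally have "(\<Sum>s\<le>N. coeff p s * (A ^\<^sub>m s) $$ (i, j)) = 0"
    by (simp add: telescope)
  moreover have "(\<Sum>s\<le>N. coeff p s * (A ^\<^sub>m s) $$ (i, j))
      = (\<Sum>s\<le>degree p. coeff p s * (A ^\<^sub>m s) $$ (i, j))"
    using N(1) by (intro sum.mono_neutral_right) (auto simp: coeff_eq_0)
  ultimately show ?thesis by (simp add: p_def)
qed

text \<open>This is the Leibniz expansion of a determinant whose row \<open>j\<close> lists the
  entries of the powers 0 to m of \<open>A\<close> at position \<open>(P j, Q j)\<close>. The
  coefficients of the characteristic polynomial form a kernel vector, nonzero because the polynomial
  is monic. The position may vary freely from row to row.\<close>

lemma alternating_sum_power_entries: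
  fixes A :: "'a :: idom mat"
  assumes A: "A \<in> carrier_mat m m"
    and P: "\<And>j. j \<le> m \<Longrightarrow> P j < m" and Q: "\<And>j. j \<le> m \<Longrightarrow> Q j < m"
  shows "(\<Sum>\<sigma> | \<sigma> permutes {0..<Suc m}. of_int (sign \<sigma>) *
    (\<Prod>j = 0..<Suc m. (A ^\<^sub>m \<sigma> j) $$ (P j, Q j))) = 0"
proof -
  define M where "M = mat (Suc m) (Suc m) (\<lambda>(j, s). (A ^\<^sub>m s) $$ (P j, Q j))"
  define v where "v = vec (Suc m) (coeff (char_poly A))"
  have M: "M \<in> carrier_mat (Suc m) (Suc m)" by (simp add: M_def)
  have deg: "degree (char_poly A) = m" "coeff (char_poly A) m = 1"
    using degree_monic_char_poly[OF A] by auto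
  have "v $ m = 1" by (simp add: v_def deg)
  then have "v \<noteq> 0\<^sub>v (Suc m)" by auto
  moreover have "M *\<^sub>v v = 0\<^sub>v (Suc m)"
  proof (rule eq_vecI)
    fix j assume "j < dim_vec (0\<^sub>v (Suc m) :: 'a vec)"
    then have j: "j \<le> m" by simp
    then have "(M *\<^sub>v v) $ j = (\<Sum>s\<le>m. coeff (char_poly A) s * (A ^\<^sub>m s) $$ (P j, Q j))"
      unfolding M_def v_def
      by (simp add: scalar_prod_def atLeast0LessThan lessThan_Suc_atMost mult.commute)
    then show "(M *\<^sub>v v) $ j = 0\<^sub>v (Suc m) $ j"
      using j cayley_hamilton_entries[OF A P[OF j] Q[OF j]] by (simp add: deg)
  qed (simp add: M_def)
  moreover have "v \<in> carrier_vec (Suc m)" by (simp add: v_def)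
  ultimately have "det M = 0"
    using det_0_iff_vec_prod_zero[OF M] by blast
  moreover have "(\<Prod>j = 0..<Suc m. M $$ (j, \<sigma> j)) = (\<Prod>j = 0..<Suc m. (A ^\<^sub>m \<sigma> j) $$ (P j, Q j))"
    if "\<sigma> permutes {0..<Suc m}" for \<sigma>
  proof (intro prod.cong refl)
    fix j assume j: "j \<in> {0..<Suc m}"
    then have "\<sigma> j \<in> {0..<Suc m}" using permutes_in_image[OF that] by blast
    then show "M $$ (j, \<sigma> j) = (A ^\<^sub>m \<sigma> j) $$ (P j, Q j)"
      using j by (simp add: M_def)
  qed
  ultimately show ?thesis
    unfolding det_def'[OF M] by simp
qed

section \<open>Products of matrix lists and their traces\<close>

lemma mat_list_prod_carrier:
  "set Ms \<subseteq> carrier_mat m m \<Longrightarrow> mat_list_prod m Ms \<in> carrier_mat m m"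
  by (induction Ms) (auto simp: mat_list_prod_def intro!: mult_carrier_mat)

lemma mat_list_prod_append:
  assumes "set Ms \<subseteq> carrier_mat m m" "set Ns \<subseteq> carrier_mat m m"
  shows "mat_list_prod m (Ms @ Ns) = mat_list_prod m Ms * mat_list_prod m Ns"
  using assms(1)
proof (induction Ms)
  case Nil
  then show ?case
    using left_mult_one_mat[OF mat_list_prod_carrier[OF assms(2)]] by (simp add: mat_list_prod_def)
next
  case (Cons M Ms)
  then have "M \<in> carrier_mat m m" "mat_list_prod m Ms \<in> carrier_mat m m"
    by (auto intro: mat_list_prod_carrier)
  then show ?case
    using Cons assoc_mult_mat[OF _ _ mat_list_prod_carrier[OF assms(2)]]
    by (simp add: mat_list_prod_def)
qed

lemma mat_list_prod_replicate:
  assumes "A \<in> carrier_mat m m"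
  shows "mat_list_prod m (replicate k A) = A ^\<^sub>m k"
proof (induction k)
  case (Suc k)
  have "mat_list_prod m (replicate (Suc k) A) = mat_list_prod m (replicate k A @ [A])"
    by (simp add: replicate_append_same)
  also have "\<dots> = A ^\<^sub>m k * A"
    using assms Suc by (subst mat_list_prod_append) (auto simp: mat_list_prod_def)
  finally show ?case by simp
qed (use assms in \<open>simp add: mat_list_prod_def\<close>)

lemma mat_trace_comm:
  fixes A B :: "'a :: comm_semiring_0 mat"
  assumes "A \<in> carrier_mat m k" "B \<in> carrier_mat k m"
  shows "mat_trace (A * B) = mat_trace (B * A)"
proof -
  have "mat_trace (A * B) = (\<Sum>i<m. \<Sum>j<k. A $$ (i, j) * B $$ (j, i))"
    using assms(1) by (simp add: mat_trace_def mult_mat_entry[OF assms])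
  also have "\<dots> = (\<Sum>j<k. \<Sum>i<m. B $$ (j, i) * A $$ (i, j))"
    by (subst sum.swap) (simp add: mult.commute)
  also have "\<dots> = mat_trace (B * A)"
    using assms(2) by (simp add: mat_trace_def mult_mat_entry[OF assms(2,1)])
  finally show ?thesis .
qed

section \<open>Words in X and Y and the alternating trace identity\<close>

text \<open>The monomial X^(a 0) Y X^(a 1) Y ... Y X^(a l), with letter 0 for X and letter 1 for the
  separator Y.\<close>

primrec power_word :: "(nat \<Rightarrow> nat) \<Rightarrow> nat \<Rightarrow> nat list" where
  "power_word a 0 = replicate (a 0) 0"
| "power_word a (Suc l) = power_word a l @ 1 # replicate (a (Suc l)) 0"

lemma set_power_word: "set (power_word a l) \<subseteq> {0, 1}"
  by (induction l) auto

lemma length_power_word: "length (power_word a l) = (\<Sum>j\<le>l. a j) + l"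
  by (induction l) auto

text \<open>The zeros after the last separator count the last exponent; removing them together with
  the separator leaves a shorter power word.\<close>

lemma power_word_inject:
  "power_word a l = power_word b l \<Longrightarrow> j \<le> l \<Longrightarrow> a j = b j"
proof (induction l)
  case 0
  then show ?case by (simp add: replicate_eq_replicate)
next
  case (Suc l)
  have tw: "takeWhile (\<lambda>i. i = 0) (rev (power_word c (Suc l))) = replicate (c (Suc l)) 0" for c
    by (simp add: takeWhile_append)
  have "replicate (a (Suc l)) (0 :: nat) = replicate (b (Suc l)) 0"
    using Suc.prems(1) tw by metis
  then have last: "a (Suc l) = b (Suc l)" by (simp add: replicate_eq_replicate)
  with Suc.prems(1) have "power_word a l = power_word b l" by simp
  with Suc last show ?case by (cases "j = Suc l") auto
qed

text \<open>
  The factors \<open>(A 0 ^\<^sub>m \<sigma> j) $$ (P j, Q j)\<close> stand for the powers not yet absorbed into the word; they make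
  the induction on \<open>l\<close> go through, with a plain determinant at \<open>l = 0\<close>.
\<close>
lemma alternating_sum_power_word_entries:
  fixes A :: "nat \<Rightarrow> 'a :: idom mat"
  assumes A: "A 0 \<in> carrier_mat m m" "A 1 \<in> carrier_mat m m"
    and "l \<le> m" "p < m" "q < m"
    and "\<And>j. j \<le> m \<Longrightarrow> P j < m" "\<And>j. j \<le> m \<Longrightarrow> Q j < m"
  shows "(\<Sum>\<sigma> | \<sigma> permutes {0..<Suc m}. of_int (sign \<sigma>) *
    (mat_list_prod m (map A (power_word \<sigma> l)) $$ (p, q) *
     (\<Prod>j = Suc l..<Suc m. (A 0 ^\<^sub>m \<sigma> j) $$ (P j, Q j)))) = 0"
  using assms(3-)
proof (induction l arbitrary: p q P Q)
  case 0
  \<comment> \<open>The word is now a single power, so its entry at \<open>(p, q)\<close> serves as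
    row 0 of the determinant.\<close>
  have "(\<Sum>\<sigma> | \<sigma> permutes {0..<Suc m}. of_int (sign \<sigma>) *
      (\<Prod>j = 0..<Suc m. (A 0 ^\<^sub>m \<sigma> j) $$ ((P(0 := p)) j, (Q(0 := q)) j))) = 0"
    using 0 by (intro alternating_sum_power_entries[OF A(1)]) auto
  then show ?case
    by (simp add: mat_list_prod_replicate[OF A(1)] prod.atLeast_Suc_lessThan del: prod.op_ivl_Suc)
next
  case (Suc l)
  let ?E = "\<lambda>\<sigma>. mat_list_prod m (map A (power_word \<sigma> l))"
  let ?R = "\<lambda>\<sigma>. \<Prod>j = Suc (Suc l)..<Suc m. (A 0 ^\<^sub>m \<sigma> j) $$ (P j, Q j)"
  have E: "?E \<sigma> \<in> carrier_mat m m" for \<sigma>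
    using A set_power_word[of \<sigma> l] by (intro mat_list_prod_carrier) auto
  \<comment> \<open>Splitting off the last Y and the power after it leaves the coefficients
    \<open>A 1 $$ (r, t)\<close>, which do not depend on \<sigma> and can leave the alternating
    sum.\<close>
  have entry: "mat_list_prod m (map A (power_word \<sigma> (Suc l))) $$ (p, q)
      = (\<Sum>r<m. \<Sum>t<m. A 1 $$ (r, t) * (?E \<sigma> $$ (p, r) * (A 0 ^\<^sub>m \<sigma> (Suc l)) $$ (t, q)))" for \<sigma>
  proof -
    have "mat_list_prod m (map A (power_word \<sigma> (Suc l)))
        = ?E \<sigma> * mat_list_prod m (A 1 # replicate (\<sigma> (Suc l)) (A 0))"
      using A set_power_word[of \<sigma> l] by (simp, subst mat_list_prod_append) auto
    also have "mat_list_prod m (A 1 # replicate (\<sigma> (Suc l)) (A 0)) = A 1 * A 0 ^\<^sub>m \<sigma> (Suc l)"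
      using mat_list_prod_replicate[OF A(1)] by (simp add: mat_list_prod_def)
    finally show ?thesis
      using Suc.prems
      by (simp add: mult_mat_entry[OF E mult_carrier_mat[OF A(2) pow_carrier_mat[OF A(1)]]]
          mult_mat_entry[OF A(2) pow_carrier_mat[OF A(1)]] sum_distrib_left mult_ac del: One_nat_def)
  qed
  have "(\<Sum>\<sigma> | \<sigma> permutes {0..<Suc m}. of_int (sign \<sigma>) *
      (mat_list_prod m (map A (power_word \<sigma> (Suc l))) $$ (p, q) * ?R \<sigma>))
    = (\<Sum>\<sigma> | \<sigma> permutes {0..<Suc m}. \<Sum>r<m. \<Sum>t<m. A 1 $$ (r, t) * (of_int (sign \<sigma>) *
        (?E \<sigma> $$ (p, r) * ((A 0 ^\<^sub>m \<sigma> (Suc l)) $$ (t, q) * ?R \<sigma>))))"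
    unfolding entry by (simp add: sum_distrib_left sum_distrib_right mult_ac)
  also have "\<dots> = (\<Sum>r<m. \<Sum>t<m. A 1 $$ (r, t) * (\<Sum>\<sigma> | \<sigma> permutes {0..<Suc m}. of_int (sign \<sigma>) *
        (?E \<sigma> $$ (p, r) * ((A 0 ^\<^sub>m \<sigma> (Suc l)) $$ (t, q) * ?R \<sigma>))))"
    by (subst sum.swap, rule sum.cong[OF refl], subst sum.swap) (simp add: sum_distrib_left)
  also have "\<dots> = 0"
  proof (intro sum.neutral ballI)
    fix r t assume rt: "r \<in> {..<m}" "t \<in> {..<m}"
    \<comment> \<open>The released power becomes the factor with index \<open>Suc l\<close> of the
      product, now at position \<open>(t, q)\<close>, which is the shape of the induction
      hypothesis.\<close>
    let ?P = "P(Suc l := t)" and ?Q = "Q(Suc l := q)"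
    have "(\<Prod>j = Suc l..<Suc m. (A 0 ^\<^sub>m \<sigma> j) $$ (?P j, ?Q j))
        = (A 0 ^\<^sub>m \<sigma> (Suc l)) $$ (t, q) * ?R \<sigma>" for \<sigma>
      using Suc.prems(1) by (subst prod.atLeast_Suc_lessThan) auto
    moreover have "(\<Sum>\<sigma> | \<sigma> permutes {0..<Suc m}. of_int (sign \<sigma>) *
        (?E \<sigma> $$ (p, r) * (\<Prod>j = Suc l..<Suc m. (A 0 ^\<^sub>m \<sigma> j) $$ (?P j, ?Q j)))) = 0"
      using Suc.prems rt by (intro Suc.IH) auto
    ultimately show "A 1 $$ (r, t) * (\<Sum>\<sigma> | \<sigma> permutes {0..<Suc m}. of_int (sign \<sigma>) *
        (?E \<sigma> $$ (p, r) * ((A 0 ^\<^sub>m \<sigma> (Suc l)) $$ (t, q) * ?R \<sigma>))) = 0"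
      by simp
  qed
  finally show ?case .
qed

text \<open>The trace of E Z is linear in the entries of E with coefficients free of \<sigma>, so
  the entrywise identity applies to each. The tail \<open>ws\<close> will be the block of letters
  2.\<close>

lemma alternating_trace_identity:
  fixes A :: "nat \<Rightarrow> 'a :: idom mat"
  assumes A: "A 0 \<in> carrier_mat m m" "A 1 \<in> carrier_mat m m"
    and ws: "set (map A ws) \<subseteq> carrier_mat m m"
  shows "(\<Sum>\<sigma> | \<sigma> permutes {0..<Suc m}. of_int (sign \<sigma>) *
    mat_trace (mat_list_prod m (map A (power_word \<sigma> m @ ws)))) = 0"
proof -
  let ?E = "\<lambda>\<sigma>. mat_list_prod m (map A (power_word \<sigma> m))"
  let ?Z = "mat_list_prod m (map A ws)"
  have E: "?E \<sigma> \<in> carrier_mat m m" for \<sigma>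
    using A set_power_word[of \<sigma> m] by (intro mat_list_prod_carrier) auto
  have Z: "?Z \<in> carrier_mat m m" by (rule mat_list_prod_carrier[OF ws])
  have tr: "mat_trace (mat_list_prod m (map A (power_word \<sigma> m @ ws)))
      = (\<Sum>i<m. \<Sum>r<m. ?Z $$ (r, i) * ?E \<sigma> $$ (i, r))" for \<sigma>
  proof -
    have prod: "mat_list_prod m (map A (power_word \<sigma> m @ ws)) = ?E \<sigma> * ?Z"
      unfolding map_append
      by (rule mat_list_prod_append) (use A ws set_power_word[of \<sigma> m] in auto)
    then show ?thesis
      using E[of \<sigma>] by (simp add: mat_trace_def mult_mat_entry[OF E Z] mult.commute)
  qed
  have "(\<Sum>\<sigma> | \<sigma> permutes {0..<Suc m}. of_int (sign \<sigma>) *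
      mat_trace (mat_list_prod m (map A (power_word \<sigma> m @ ws))))
    = (\<Sum>\<sigma> | \<sigma> permutes {0..<Suc m}. \<Sum>i<m. \<Sum>r<m. ?Z $$ (r, i) * (of_int (sign \<sigma>) * ?E \<sigma> $$ (i, r)))"
    unfolding tr by (simp add: sum_distrib_left mult_ac)
  also have "\<dots> = (\<Sum>i<m. \<Sum>r<m. ?Z $$ (r, i) *
      (\<Sum>\<sigma> | \<sigma> permutes {0..<Suc m}. of_int (sign \<sigma>) * ?E \<sigma> $$ (i, r)))"
    by (subst sum.swap, rule sum.cong[OF refl], subst sum.swap) (simp add: sum_distrib_left)
  also have "\<dots> = 0"
  proof (intro sum.neutral ballI)
    fix i r assume "i \<in> {..<m}" "r \<in> {..<m}"
    then have "(\<Sum>\<sigma> | \<sigma> permutes {0..<Suc m}. of_int (sign \<sigma>) * ?E \<sigma> $$ (i, r)) = 0"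
      using alternating_sum_power_word_entries[OF A, of m i r "\<lambda>_. i" "\<lambda>_. r"] by simp
    then show "?Z $$ (r, i) *
        (\<Sum>\<sigma> | \<sigma> permutes {0..<Suc m}. of_int (sign \<sigma>) * ?E \<sigma> $$ (i, r)) = 0" by simp
  qed
  finally show ?thesis .
qed

section \<open>The space of cyclically invariant tensors\<close>

lemma permute_list_cyclic_shift: "permute_list (cyclic_shift (length xs)) xs = rotate1 xs"
  by (rule nth_equalityI)
    (simp_all add: permute_list_nth[OF cyclic_shift_permutes] nth_rotate1 cyclic_shift_def)

lemma group_perm_group: "group (perm_group d)"
proof (rule groupI)
  fix \<sigma> assume "\<sigma> \<in> carrier (perm_group d)"
  then show "\<exists>\<tau>\<in>carrier (perm_group d). \<tau> \<otimes>\<^bsub>perm_group d\<^esub> \<sigma> = \<one>\<^bsub>perm_group d\<^esub>"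
    by (intro bexI[of _ "inv_into UNIV \<sigma>"])
      (auto simp: perm_group_def permutes_inv permutes_inv_o)
qed (auto simp: perm_group_def permutes_compose permutes_id o_assoc)

text \<open>Invariance under the generator passes to its inverse and to products, hence to the whole
  cyclic group.\<close>

lemma Cyc_altdef:
  "Cyc n d = {T \<in> tensors n d. \<forall>is. length is = d \<longrightarrow> T (rotate1 is) = T is}"
proof (intro equalityI subsetI)
  fix T assume T: "T \<in> Cyc n d"
  have "cyclic_shift d \<in> cyclic_perms d"
    unfolding cyclic_perms_def by (simp add: generate.incl)
  with T have "tensor_act (cyclic_shift d) T = T" by (simp add: Cyc_def)
  then have "T (permute_list (cyclic_shift d) is) = T is" for "is"
    by (metis tensor_act_def)
  then show "T \<in> {T \<in> tensors n d. \<forall>is. length is = d \<longrightarrow> T (rotate1 is) = T is}"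
    using T by (auto simp: Cyc_def simp flip: permute_list_cyclic_shift)
next
  fix T assume "T \<in> {T \<in> tensors n d. \<forall>is. length is = d \<longrightarrow> T (rotate1 is) = T is}"
  then have T: "T \<in> tensors n d" and rot: "\<And>is. length is = d \<Longrightarrow> T (rotate1 is) = T is" by auto
  interpret group "perm_group d" by (rule group_perm_group)
  have shift: "T (permute_list (cyclic_shift d) is) = T is" if "length is = d" for "is"
    using rot[OF that] permute_list_cyclic_shift[of "is"] that by simp
  have shift_carrier: "cyclic_shift d \<in> carrier (perm_group d)"
    by (simp add: perm_group_def cyclic_shift_permutes)
  \<comment> \<open>The induction also carries \<open>permutes\<close>, since
    \<open>permute_list_compose\<close> asks for it in the product case.\<close>
  have "\<sigma> permutes {..<d} \<and> (\<forall>is. length is = d \<longrightarrow> T (permute_list \<sigma> is) = T is)"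
    if "\<sigma> \<in> cyclic_perms d" for \<sigma>
    using that unfolding cyclic_perms_def
  proof (induction rule: generate.induct)
    case one
    then show ?case using permutes_id[of "{..<d}"] by (simp add: perm_group_def id_def)
  next
    case (incl \<sigma>)
    then show ?case using shift cyclic_shift_permutes by simp
  next
    case (inv \<sigma>)
    then have [simp]: "\<sigma> = cyclic_shift d" by simp
    let ?\<tau> = "inv\<^bsub>perm_group d\<^esub> \<sigma>"
    have \<tau>: "?\<tau> permutes {..<d}"
      using inv_closed[OF shift_carrier] by (simp add: perm_group_def)
    have comp: "?\<tau> \<circ> \<sigma> = id"
      using l_inv[OF shift_carrier] by (simp add: perm_group_def)
    have "T (permute_list ?\<tau> is) = T is" if "length is = d" for "is"
    proof -
      have "permute_list \<sigma> (permute_list ?\<tau> is) = is"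
        using permute_list_compose[of \<sigma> "is" ?\<tau>] comp that cyclic_shift_permutes by simp
      then show ?thesis
        using shift[of "permute_list ?\<tau> is"] that by simp
    qed
    with \<tau> show ?case by blast
  next
    case (eng \<sigma> \<tau>)
    then have "\<sigma> \<circ> \<tau> permutes {..<d}" by (auto intro: permutes_compose)
    moreover have "T (permute_list (\<sigma> \<circ> \<tau>) is) = T is" if "length is = d" for "is"
      using eng that by (simp add: permute_list_compose)
    ultimately show ?case by (simp add: perm_group_def comp_def)
  qed
  \<comment> \<open>At lists of any other length both sides are 0, because
    \<open>permute_list\<close> preserves the length.\<close>
  then have "tensor_act \<sigma> T is = T is" if "\<sigma> \<in> cyclic_perms d" for \<sigma> "is"
    using that T by (cases "length is = d") (auto simp: tensor_act_def tensors_def multi_indices_def)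
  then show "T \<in> Cyc n d"
    using T by (auto simp: Cyc_def)
qed

text \<open>Rotation moves the first factor to the end, which the trace does not see.\<close>

lemma mps_map_in_Cyc:
  assumes A: "\<And>i. i < n \<Longrightarrow> A i \<in> carrier_mat m m"
  shows "mps_map m n d A \<in> Cyc n d"
  unfolding Cyc_altdef
proof (intro CollectI conjI allI impI)
  show "mps_map m n d A \<in> tensors n d"
    by (simp add: tensors_def mps_map_coord)
  fix "is" :: "nat list" assume "length is = d"
  show "mps_map m n d A (rotate1 is) = mps_map m n d A is"
  proof (cases "is \<in> multi_indices n d \<and> is \<noteq> []")
    case True
    then obtain i js where [simp]: "is = i # js" by (cases "is") auto
    have i: "A i \<in> carrier_mat m m" and js: "set (map A js) \<subseteq> carrier_mat m m"
      using True A by (auto simp: multi_indices_def)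
    have "mat_list_prod m (map A js @ [A i]) = mat_list_prod m (map A js) * A i"
      using mat_list_prod_append[OF js, of "[A i]"] i by (simp add: mat_list_prod_def)
    then show ?thesis
      using True mat_trace_comm[OF i mat_list_prod_carrier[OF js]]
      by (simp add: mps_map_coord multi_indices_def) (simp add: mat_list_prod_def)
  qed (auto simp: mps_map_coord multi_indices_def)
qed

lemma closed_tensors: "closed (tensors n d)"
proof -
  have "tensors n d = (\<Inter>is\<in>- multi_indices n d. {T. T is = 0})"
    by (auto simp: tensors_def)
  also have "closed \<dots>"
    by (intro closed_INT ballI closed_Collect_eq continuous_on_product_coordinates continuous_on_const)
  finally show ?thesis .
qed

lemma closed_Cyc: "closed (Cyc n d)"
proof -
  have "Cyc n d = tensors n d \<inter> (\<Inter>is\<in>{is. length is = d}. {T. T (rotate1 is) = T is})"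
    by (auto simp: Cyc_altdef)
  also have "closed \<dots>"
    by (intro closed_Int closed_tensors closed_INT ballI closed_Collect_eq
        continuous_on_product_coordinates)
  finally show ?thesis .
qed

lemma subspace_Cyc: "tensor.subspace (Cyc n d)"
  by (rule tensor.subspaceI) (auto simp: Cyc_altdef tensors_def tensor_scale_def)

section \<open>Orbit sums and words with a marked end\<close>

text \<open>The sum of all rotations of the basis tensor of \<open>w\<close>. Rotations are counted
  with multiplicity if \<open>w\<close> is periodic, which avoids choosing orbit
  representatives.\<close>

definition orbit_sum :: "nat list \<Rightarrow> tensor" where
  "orbit_sum w = (\<lambda>is. \<Sum>r<length w. if rotate r is = w then 1 else 0)"

lemma orbit_sum_in_Cyc:
  assumes "w \<in> multi_indices n d"
  shows "orbit_sum w \<in> Cyc n d"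
  unfolding Cyc_altdef
proof (intro CollectI conjI allI impI)
  have "is \<in> multi_indices n d" if "rotate r is = w" for r "is"
    using that assms by (auto simp: multi_indices_def)
  then show "orbit_sum w \<in> tensors n d"
    by (auto simp: tensors_def orbit_sum_def intro!: sum.neutral)
  fix "is" :: "nat list" assume len: "length is = d"
  define f where "f r = (if rotate r is = w then 1 else 0 :: complex)" for r
  have d: "length w = d" using assms by (simp add: multi_indices_def)
  \<comment> \<open>The full rotation is trivial, so shifting the summation index by one only
    permutes the terms cyclically.\<close>
  have "rotate d is = is" using len by (metis rotate_id mod_self)
  then have "f d = f 0" by (simp add: f_def)
  have "orbit_sum w (rotate1 is) = (\<Sum>r<d. f (Suc r))"
    by (simp add: orbit_sum_def d f_def rotate1_rotate_swap)
  also have "\<dots> = (\<Sum>r<d. f r)"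
    using sum.lessThan_Suc_shift[of f d] sum.lessThan_Suc[of f d] \<open>f d = f 0\<close>
    by (simp add: add.commute)
  finally show "orbit_sum w (rotate1 is) = orbit_sum w is"
    by (simp add: orbit_sum_def d f_def)
qed

text \<open>A nontrivial rotation that cuts within or right after \<open>u\<close> ends in a letter
  of \<open>u\<close>, hence not in \<open>c\<close>. One that cuts inside the block starts with
  \<open>c\<close>, whereas \<open>v\<close> is nonempty and starts with another letter.\<close>

lemma rotate_terminal_block:
  assumes eq: "rotate r (u @ replicate k c) = v @ replicate k c"
    and r: "r < length u + k" and k: "k > 0"
    and u: "c \<notin> set u" and v: "c \<notin> set v" "v \<noteq> []"
  shows "r = 0"
proof (rule ccontr)
  assume "r \<noteq> 0"
  have split: "drop r (u @ replicate k c) @ take r (u @ replicate k c) = v @ replicate k c"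
    using eq r by (simp add: rotate_drop_take)
  show False
  proof (cases "r \<le> length u")
    case True
    then have "take r u \<noteq> []" using \<open>r \<noteq> 0\<close> by (cases u) auto
    with True have "last (drop r (u @ replicate k c) @ take r (u @ replicate k c)) \<in> set (take r u)"
      by simp
    then have "last (v @ replicate k c) \<in> set (take r u)"
      unfolding split .
    with k have "c \<in> set (take r u)" by simp
    with u show False by (blast dest: in_set_takeD)
  next
    case False
    then have "hd (drop r (u @ replicate k c) @ take r (u @ replicate k c)) = c"
      using r by simp
    then have "hd (v @ replicate k c) = c" unfolding split .
    with v(2) have "hd v = c" by simp
    with v show False using hd_in_set by blast
  qed
qed

section \<open>The separating linear form\<close>

theorem corollary4p6:
  fixes m n d :: nat
  assumes "m > 0" and "n > 0" and "d > 0"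
    and "n \<ge> 3" and "real d \<ge> real ((m + 1) * (m + 2)) / 2"
  shows "\<exists>W. tensor.subspace W \<and> W \<subset> Cyc n d \<and> uMPS m n d \<subseteq> W"
proof -
  define k where "k = d - ((\<Sum>j\<le>m. j) + m)"
  have "(\<Sum>j\<le>m. j) = m * (m + 1) div 2"
    using gauss_sum_nat[of m] by (simp add: atLeast0AtMost)
  then have "2 * (\<Sum>j\<le>m. j) = m * (m + 1)" by simp
  moreover have "real (2 * d) \<ge> real ((m + 1) * (m + 2))" using assms(5) by simp
  then have "2 * d \<ge> (m + 1) * (m + 2)" by (simp only: of_nat_le_iff)
  \<comment> \<open>m(m+1) + 2m is (m+1)(m+2) - 2, so there is room for at least one letter of the
    final block.\<close>
  ultimately have "2 * ((\<Sum>j\<le>m. j) + m) < 2 * d" by (simp add: algebra_simps)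
  then have k: "k > 0" "(\<Sum>j\<le>m. j) + m + k = d" by (auto simp: k_def)
  define S where "S = {\<sigma>. \<sigma> permutes {0..<Suc m}}"
  have fin: "finite S" by (simp add: S_def finite_permutations)
  \<comment> \<open>Letter 2 plays the role of Z; it is a legal index because
    \<open>n \<ge> 3\<close>.\<close>
  define w where "w \<sigma> = power_word \<sigma> m @ replicate k 2" for \<sigma>
  \<comment> \<open>Permuting the exponents preserves their sum, so all words have length
    \<open>d\<close>.\<close>
  have len: "length (power_word \<sigma> m) + k = d" if "\<sigma> \<in> S" for \<sigma>
  proof -
    have "(\<Sum>j\<le>m. \<sigma> j) = (\<Sum>j\<le>m. j)"
      using sum.permute[of \<sigma> "{0..<Suc m}" "\<lambda>j. j"] that
      by (simp add: S_def o_def atLeast0LessThan lessThan_Suc_atMost)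
    then show ?thesis using k by (simp add: length_power_word)
  qed
  have w: "w \<sigma> \<in> multi_indices n d" if "\<sigma> \<in> S" for \<sigma>
    using len[OF that] set_power_word[of \<sigma> m] assms(4) by (auto simp: w_def multi_indices_def)
  define L :: "tensor \<Rightarrow> complex" where "L T = (\<Sum>\<sigma>\<in>S. of_int (sign \<sigma>) * T (w \<sigma>))" for T
  define W where "W = Cyc n d \<inter> {T. L T = 0}"
  have "tensor.subspace {T. L T = 0}"
  proof (rule tensor.subspaceI)
    fix T T' c assume "T \<in> {T. L T = 0}" "T' \<in> {T. L T = 0}"
    moreover have "L (T + T') = L T + L T'"
      by (simp add: L_def distrib_left sum.distrib)
    moreover have "L (tensor_scale c T) = c * L T"
      by (simp add: L_def tensor_scale_def sum_distrib_left mult_ac)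
    ultimately show "T + T' \<in> {T. L T = 0}" "tensor_scale c T \<in> {T. L T = 0}" by simp_all
  qed (simp add: L_def)
  then have "tensor.subspace W"
    unfolding W_def by (rule tensor.subspace_inter[OF subspace_Cyc])
  moreover have "W \<subset> Cyc n d"
  proof -
    \<comment> \<open>Among the words \<open>w \<sigma>\<close>, this witness has a nonzero
      coordinate only at \<open>w id\<close>, and that coordinate is 1. Hence \<open>L T\<close> is
      the sign of \<open>id\<close>.\<close>
    define T where "T = orbit_sum (w id)"
    have two_notin: "2 \<notin> set (power_word a m)" for a using set_power_word[of a m] by auto
    have id: "id \<in> S" by (simp add: S_def permutes_id)
    have "T (w \<sigma>) = (if \<sigma> = id then 1 else 0)" if \<sigma>: "\<sigma> \<in> S" for \<sigma>
    proof -
      \<comment> \<open>Here \<open>m > 0\<close> matters: for \<open>m = 0\<close> the word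
        \<open>w id\<close> would be a bare block, fixed by every rotation.\<close>
      have "power_word id m \<noteq> []" using assms(1) by (cases m) auto
      then have r: "r = 0" if "r < d" "rotate r (w \<sigma>) = w id" for r
        using that rotate_terminal_block[of r "power_word \<sigma> m" k 2 "power_word id m"] len[OF \<sigma>] k(1)
        by (auto simp: w_def two_notin)
      have "\<sigma> = id" if "w \<sigma> = w id"
      proof
        fix j
        have "\<sigma> j = j" if "j \<le> m"
          using power_word_inject[of \<sigma> m id j] \<open>w \<sigma> = w id\<close> that by (simp add: w_def)
        moreover have "\<sigma> j = j" if "\<not> j \<le> m"
          using \<sigma> that by (auto simp: S_def intro: permutes_not_in)
        ultimately show "\<sigma> j = id j" by (cases "j \<le> m") auto
      qed
      then have *: "(rotate r (w \<sigma>) = w id) = (r = 0 \<and> \<sigma> = id)" if "r < d" for r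
        using r[OF that] by auto
      have "length (w id) = d" using w[OF id] by (simp add: multi_indices_def)
      then have "T (w \<sigma>) = (\<Sum>r<d. if rotate r (w \<sigma>) = w id then 1 else 0)"
        by (simp add: T_def orbit_sum_def)
      also have "\<dots> = (\<Sum>r<d. if r = 0 then if \<sigma> = id then 1 else 0 else 0)"
        by (intro sum.cong refl) (simp add: *)
      also have "\<dots> = (if \<sigma> = id then 1 else 0)" using assms(3) by simp
      finally show ?thesis .
    qed
    then have "L T = (\<Sum>\<sigma>\<in>S. if \<sigma> = id then of_int (sign \<sigma>) else 0)"
      unfolding L_def by (intro sum.cong) auto
    also have "\<dots> = 1" using id fin by (simp add: sign_id)
    finally have "T \<notin> W" by (simp add: W_def)
    moreover have "T \<in> Cyc n d" unfolding T_def by (rule orbit_sum_in_Cyc[OF w[OF id]])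
    ultimately show ?thesis unfolding W_def by blast
  qed
  moreover have "uMPS m n d \<subseteq> W"
    unfolding uMPS_def
  proof (rule closure_minimal)
    \<comment> \<open>\<open>L\<close> is a finite combination of coordinates, hence continuous for
      the product topology; this carries the identity from the image to its closure.\<close>
    have "closed {T. L T = 0}"
      unfolding L_def
      by (intro closed_Collect_eq continuous_intros continuous_on_product_coordinates)
    then show "closed W" unfolding W_def by (intro closed_Int closed_Cyc)
    show "mps_map m n d ` {A. \<forall>i<n. A i \<in> carrier_mat m m} \<subseteq> W"
    proof (intro image_subsetI)
      fix A :: "nat \<Rightarrow> complex mat" assume "A \<in> {A. \<forall>i<n. A i \<in> carrier_mat m m}"
      then have A: "\<And>i. i < n \<Longrightarrow> A i \<in> carrier_mat m m" by simp
      have "L (mps_map m n d A) = (\<Sum>\<sigma>\<in>S. of_int (sign \<sigma>) *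
          mat_trace (mat_list_prod m (map A (w \<sigma>))))"
        unfolding L_def by (intro sum.cong refl) (simp add: mps_map_coord w)
      also have "\<dots> = 0"
        unfolding S_def w_def
        by (rule alternating_trace_identity) (use A assms(4) in auto)
      finally show "mps_map m n d A \<in> W"
        using mps_map_in_Cyc[OF A] by (simp add: W_def)
    qed
  qed
  ultimately show ?thesis by blast
qed

end
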